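(* Let $1\le p\le\infty$, let $u,\psi$ be entire functions on $\mathbb{C}$ such that the weighted composition operator $W_{(u,\psi)}$ is bounded on the Fock space $\mathcal{F}_p$, and let $\psi(z)=az+b$ with $a,b\in\mathbb{C}$. If $|a|=1$, then the following statements are equivalent: (i) $W_{(u,\psi)}$ is power bounded on $\mathcal{F}_p$; (ii) $(\|u_n\|_p)_{n}$ is a bounded sequence, where $u_n(z)=\prod_{j=0}^{n-1}u(\psi^j(z))$; (iii) $|u(0)|\le e^{-|b|^2/2}$. Moreover, in this case, for each $n\in\mathbb{N}$ the operator norm on $\mathcal{F}_p$ satisfies $$\|W_{(u,\psi)}^n\|=\Big(|u(0)|\,e^{\frac{|b|^2}{2}}\Big)^n.$$
   Context: For $1\le p<\infty$, the Fock space $\mathcal{F}_p$ consists of all entire functions $f$ on $\mathbb{C}$ with $\|f\|_p=\Big(\frac{p}{2\pi}\int_{\mathbb{C}}|f(z)|^pe^{-\frac{p|z|^2}{2}}dA(z)\Big)^{1/p}<\infty$, where $dA$ is Lebesgue area measure; $\mathcal{F}_\infty$ consists of all entire $f$ with $\|f\|_\infty=\sup_{z\in\mathbb{C}}|f(z)|e^{-\frac{|z|^2}{2}}<\infty$. For entire $u,\psi$, the weighted composition operator is $W_{(u,\psi)}f=u\cdot (f\circ\psi)$. Here $\psi^j$ denotes the $j$-th iterate of $\psi$ under composition, $\psi^0$ being the identity map. A bounded operator $T$ on a Banach space is power bounded if $\sup_{n\in\mathbb{N}}\|T^n\|<\infty$. *)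

theory Defs
  imports "HOL-Analysis.Analysis"
begin

text \<open>
  The norm is defined for every function on the complex plane and takes values in \<open>[0, \<infinity>]\<close>, so that
  membership in the Fock space is finiteness of the norm. As \<open>powr\<close> is not available on \<open>ennreal\<close>,
  the \<open>p\<close>-th root is taken in the reals when the integral is finite. The exponent is an \<open>ennreal\<close>, with
  \<open>p = \<infinity>\<close> included, and is only meaningful for \<open>1 \<le> p\<close>.
\<close>

definition fock_integral :: "real \<Rightarrow> (complex \<Rightarrow> complex) \<Rightarrow> ennreal" where
  "fock_integral r f =
     (\<integral>\<^sup>+ z. ennreal (cmod (f z) powr r * exp (- r * (cmod z)\<^sup>2 / 2)) \<partial>lborel)"

definition fock_norm :: "ennreal \<Rightarrow> (complex \<Rightarrow> complex) \<Rightarrow> ennreal" where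
  "fock_norm p f =
     (if p = \<infinity> then (SUP z. ennreal (cmod (f z) * exp (- (cmod z)\<^sup>2 / 2)))
      else let r = enn2real p; I = fock_integral r f in
        if I = \<infinity> then \<infinity>
        else ennreal ((r / (2 * pi) * enn2real I) powr (1 / r)))"

definition fock_space :: "ennreal \<Rightarrow> (complex \<Rightarrow> complex) set" where
  "fock_space p = {f. f holomorphic_on UNIV \<and> fock_norm p f < \<infinity>}"

definition weighted_comp ::
    "(complex \<Rightarrow> complex) \<Rightarrow> (complex \<Rightarrow> complex) \<Rightarrow> (complex \<Rightarrow> complex) \<Rightarrow> (complex \<Rightarrow> complex)" where
  "weighted_comp u \<psi> f = (\<lambda>z. u z * f (\<psi> z))"

text \<open>
  Operators on the Fock space are maps on all functions; only their values on \<open>fock_space p\<close> matter.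
\<close>

definition fock_opnorm ::
    "ennreal \<Rightarrow> ((complex \<Rightarrow> complex) \<Rightarrow> (complex \<Rightarrow> complex)) \<Rightarrow> ennreal" where
  "fock_opnorm p T = (SUP f \<in> {f \<in> fock_space p. fock_norm p f \<le> 1}. fock_norm p (T f))"

definition fock_bounded ::
    "ennreal \<Rightarrow> ((complex \<Rightarrow> complex) \<Rightarrow> (complex \<Rightarrow> complex)) \<Rightarrow> bool" where
  "fock_bounded p T \<longleftrightarrow>
     T ` fock_space p \<subseteq> fock_space p \<and>
     (\<forall>f \<in> fock_space p. \<forall>g \<in> fock_space p. T (\<lambda>z. f z + g z) = (\<lambda>z. T f z + T g z)) \<and>
     (\<forall>c. \<forall>f \<in> fock_space p. T (\<lambda>z. c * f z) = (\<lambda>z. c * T f z)) \<and>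
     fock_opnorm p T < \<infinity>"

definition fock_power_bounded ::
    "ennreal \<Rightarrow> ((complex \<Rightarrow> complex) \<Rightarrow> (complex \<Rightarrow> complex)) \<Rightarrow> bool" where
  "fock_power_bounded p T \<longleftrightarrow> fock_bounded p T \<and> (SUP n. fock_opnorm p (T ^^ n)) < \<infinity>"

definition weight_prod ::
    "(complex \<Rightarrow> complex) \<Rightarrow> (complex \<Rightarrow> complex) \<Rightarrow> nat \<Rightarrow> complex \<Rightarrow> complex" where
  "weight_prod u \<psi> n z = (\<Prod>j<n. u ((\<psi> ^^ j) z))"

end

theory Submission
  imports Defs "HOL-Complex_Analysis.Complex_Analysis" "HOL-Probability.Distributions"
begin

text \<open>
  Write \<open>|f(z)| exp(-|z|\<^sup>2/2)\<close> as the modulus whose \<open>L\<^sup>p\<close> norm is the Fock norm. Area measure is invariant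
  under \<open>z \<mapsto> a z + b\<close> for \<open>|a| = 1\<close>, so two functions whose moduli differ by a factor \<open>c\<close> and such a
  substitution have norms differing by the factor \<open>c\<close>. In particular all the normalised kernels
  \<open>k\<^sub>w(z) = exp(cnj w z - |w|\<^sup>2/2)\<close> have norm 1. Point evaluations are bounded by the mean value property,
  and evaluating \<open>W k\<^sub>w\<close> at \<open>z\<close> with \<open>w = \<psi>(z)\<close> shows that the entire function \<open>u(z) exp(a cnj b z)\<close> is
  bounded. By Liouville it is constant, so \<open>u(z) = u(0) exp(-a cnj b z)\<close>. As
  \<open>|a z + b|\<^sup>2 = |z|\<^sup>2 + |b|\<^sup>2 + 2 Re(a cnj b z)\<close>, this makes \<open>W\<close> the multiple \<open>|u(0)| exp(|b|\<^sup>2/2)\<close> of an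
  isometry, and \<open>u\<^sub>n = W\<^sup>n 1\<close>.
\<close>

section \<open>Area measure on the complex plane: iterated integrals and rigid motions\<close>

text \<open>A measure on the Borel sets that gives every box its volume is Lebesgue measure, so only
  boxes need checking. This opens the complex plane to Tonelli's theorem in real and imaginary
  parts.\<close>

lemma lborel_complex_eq_distr:
  "(lborel :: complex measure) = distr (lborel \<Otimes>\<^sub>M lborel) borel (\<lambda>(x, y). Complex x y)"
proof (rule lborel_eqI)
  show "sets (distr (lborel \<Otimes>\<^sub>M lborel) borel (\<lambda>(x, y). Complex x y)) = sets borel"
    by simp
next
  fix l u :: complex
  assume lu: "\<And>b. b \<in> Basis \<Longrightarrow> l \<bullet> b \<le> u \<bullet> b"
  have le: "Re l \<le> Re u" "Im l \<le> Im u"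
    using lu[of 1] lu[of \<i>] by (auto simp: Basis_complex_def inner_complex_def)
  have meas: "(\<lambda>(x, y). Complex x y) \<in> lborel \<Otimes>\<^sub>M lborel \<rightarrow>\<^sub>M borel"
    by (simp add: borel_measurable_complex_iff split_beta)
  have pre: "(\<lambda>(x, y). Complex x y) -` box l u \<inter> space (lborel \<Otimes>\<^sub>M lborel) =
      {Re l<..<Re u} \<times> {Im l<..<Im u}"
    by (auto simp: box_def Basis_complex_def inner_complex_def space_pair_measure)
  have "emeasure (distr (lborel \<Otimes>\<^sub>M lborel) borel (\<lambda>(x, y). Complex x y)) (box l u) =
      emeasure (lborel \<Otimes>\<^sub>M lborel) ({Re l<..<Re u} \<times> {Im l<..<Im u})"
    by (subst emeasure_distr[OF meas]) (auto simp: pre)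
  also have "\<dots> = ennreal (Re u - Re l) * ennreal (Im u - Im l)"
    using le by (subst lborel.emeasure_pair_measure_Times) auto
  also have "\<dots> = (\<Prod>b\<in>Basis. (u - l) \<bullet> b)"
    using le by (simp add: Basis_complex_def inner_complex_def ennreal_mult)
  finally show "emeasure (distr (lborel \<Otimes>\<^sub>M lborel) borel (\<lambda>(x, y). Complex x y)) (box l u) =
      (\<Prod>b\<in>Basis. (u - l) \<bullet> b)" .
qed

lemma measurable_Complex [measurable (raw)]:
  assumes "f \<in> borel_measurable M" "g \<in> borel_measurable M"
  shows "(\<lambda>x. Complex (f x) (g x)) \<in> borel_measurable M"
  using assms by (simp add: borel_measurable_complex_iff)

text \<open>Both orders of integration are kept because a shear is handled with the coordinate that
  it moves innermost.\<close>

lemma nn_integral_complex: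
  fixes f :: "complex \<Rightarrow> ennreal"
  assumes [measurable]: "f \<in> borel_measurable borel"
  shows "(\<integral>\<^sup>+ z. f z \<partial>lborel) = (\<integral>\<^sup>+ y. \<integral>\<^sup>+ x. f (Complex x y) \<partial>lborel \<partial>lborel)"
    and "(\<integral>\<^sup>+ z. f z \<partial>lborel) = (\<integral>\<^sup>+ x. \<integral>\<^sup>+ y. f (Complex x y) \<partial>lborel \<partial>lborel)"
proof -
  have eq: "(\<integral>\<^sup>+ z. f z \<partial>lborel) = (\<integral>\<^sup>+ w. f (Complex (fst w) (snd w)) \<partial>(lborel \<Otimes>\<^sub>M lborel))"
    by (subst lborel_complex_eq_distr, subst nn_integral_distr) (auto simp: split_beta)
  show "(\<integral>\<^sup>+ z. f z \<partial>lborel) = (\<integral>\<^sup>+ x. \<integral>\<^sup>+ y. f (Complex x y) \<partial>lborel \<partial>lborel)"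
    unfolding eq by (subst lborel.nn_integral_fst[symmetric]) auto
  show "(\<integral>\<^sup>+ z. f z \<partial>lborel) = (\<integral>\<^sup>+ y. \<integral>\<^sup>+ x. f (Complex x y) \<partial>lborel \<partial>lborel)"
    unfolding eq by (subst lborel_pair.nn_integral_snd[symmetric]) auto
qed

lemma nn_integral_real_translate:
  fixes f :: "real \<Rightarrow> ennreal"
  assumes "f \<in> borel_measurable borel"
  shows "(\<integral>\<^sup>+ x. f (x + t) \<partial>lborel) = (\<integral>\<^sup>+ x. f x \<partial>lborel)"
  using nn_integral_real_affine[OF assms, of 1 t] by (simp add: add.commute)

lemma nn_integral_complex_translate:
  fixes f :: "complex \<Rightarrow> ennreal"
  assumes [measurable]: "f \<in> borel_measurable borel"
  shows "(\<integral>\<^sup>+ z. f (z + b) \<partial>lborel) = (\<integral>\<^sup>+ z. f z \<partial>lborel)"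
proof -
  have "(\<integral>\<^sup>+ z. f (z + b) \<partial>lborel) =
      (\<integral>\<^sup>+ y. \<integral>\<^sup>+ x. f (Complex (x + Re b) (y + Im b)) \<partial>lborel \<partial>lborel)"
    by (subst nn_integral_complex(1)) (auto simp: complex_eq_iff intro!: nn_integral_cong arg_cong[of _ _ f])
  also have "\<dots> = (\<integral>\<^sup>+ y. \<integral>\<^sup>+ x. f (Complex x (y + Im b)) \<partial>lborel \<partial>lborel)"
    by (intro nn_integral_cong nn_integral_real_translate) auto
  also have "\<dots> = (\<integral>\<^sup>+ y. \<integral>\<^sup>+ x. f (Complex x y) \<partial>lborel \<partial>lborel)"
    by (rule nn_integral_real_translate) auto
  finally show ?thesis
    by (simp add: nn_integral_complex(1))
qed

text \<open>On each line parallel to the moved axis, a shear is a translation by a fixed amount, so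
  it leaves the inner integral unchanged.\<close>

lemma nn_integral_complex_shear:
  fixes f :: "complex \<Rightarrow> ennreal" and t :: real
  assumes [measurable]: "f \<in> borel_measurable borel"
  shows "(\<integral>\<^sup>+ z. f (z + t * Im z) \<partial>lborel) = (\<integral>\<^sup>+ z. f z \<partial>lborel)" (is ?A)
    and "(\<integral>\<^sup>+ z. f (z + \<i> * t * Re z) \<partial>lborel) = (\<integral>\<^sup>+ z. f z \<partial>lborel)" (is ?B)
proof -
  have "(\<integral>\<^sup>+ z. f (z + t * Im z) \<partial>lborel) =
      (\<integral>\<^sup>+ y. \<integral>\<^sup>+ x. f (Complex (x + t * y) y) \<partial>lborel \<partial>lborel)"
    by (subst nn_integral_complex(1)) (auto simp: complex_eq_iff intro!: nn_integral_cong arg_cong[of _ _ f])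
  also have "\<dots> = (\<integral>\<^sup>+ y. \<integral>\<^sup>+ x. f (Complex x y) \<partial>lborel \<partial>lborel)"
    by (intro nn_integral_cong nn_integral_real_translate) auto
  finally show ?A
    by (simp add: nn_integral_complex(1))
  have "(\<integral>\<^sup>+ z. f (z + \<i> * t * Re z) \<partial>lborel) =
      (\<integral>\<^sup>+ x. \<integral>\<^sup>+ y. f (Complex x (y + t * x)) \<partial>lborel \<partial>lborel)"
    by (subst nn_integral_complex(2)) (auto simp: complex_eq_iff intro!: nn_integral_cong arg_cong[of _ _ f])
  also have "\<dots> = (\<integral>\<^sup>+ x. \<integral>\<^sup>+ y. f (Complex x y) \<partial>lborel \<partial>lborel)"
    by (intro nn_integral_cong nn_integral_real_translate) auto
  finally show ?B
    by (simp add: nn_integral_complex(2))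
qed

text \<open>
  A rotation by \<open>\<theta> \<noteq> \<pi>\<close> is a product of three shears, with parameters \<open>- tan (\<theta> / 2)\<close>,
  \<open>sin \<theta>\<close> and \<open>- tan (\<theta> / 2)\<close>; the rotation by \<open>\<pi>\<close> is a square.
\<close>

lemma nn_integral_complex_rotate:
  fixes f :: "complex \<Rightarrow> ennreal"
  assumes [measurable]: "f \<in> borel_measurable borel" and a: "cmod a = 1"
  shows "(\<integral>\<^sup>+ z. f (a * z) \<partial>lborel) = (\<integral>\<^sup>+ z. f z \<partial>lborel)"
proof -
  have rot: "(\<integral>\<^sup>+ z. g (c * z) \<partial>lborel) = (\<integral>\<^sup>+ z. g z \<partial>lborel)"
    if [measurable]: "g \<in> borel_measurable borel" and c: "cmod c = 1" "c \<noteq> -1"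
    for g :: "complex \<Rightarrow> ennreal" and c
  proof -
    have sq: "(Re c)\<^sup>2 + (Im c)\<^sup>2 = 1"
      using c(1) by (simp add: cmod_def)
    have nz: "1 + Re c \<noteq> 0"
    proof
      assume "1 + Re c = 0"
      then have "Re c = -1" by simp
      with sq show False using c(2) by (simp add: complex_eq_iff)
    qed
    define s t where "s = Im c" and "t = - Im c / (1 + Re c)"
    define S where "S = (\<lambda>z::complex. z + t * Im z)"
    define R where "R = (\<lambda>z::complex. z + \<i> * s * Re z)"
    have [measurable]: "S \<in> borel_measurable borel" "R \<in> borel_measurable borel"
      unfolding S_def R_def by measurable
    have "t + t * Re c = t * (1 + Re c)"
      by (simp add: algebra_simps)
    with nz have "t + t * Re c = - Im c"
      by (simp add: t_def)
    moreover have "1 + s * t = Re c"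
      using nz sq by (simp add: s_def t_def field_simps power2_eq_square)
    ultimately have t: "1 + s * t = Re c" "t + t * Re c = - Im c"
      by simp_all
    \<comment> \<open>As a real matrix, \<open>S\<close> after \<open>R\<close> after
      \<open>S\<close> has diagonal entries \<open>1 + s * t\<close>, lower left entry
      \<open>s\<close> and upper right entry \<open>t + t * (1 + s * t)\<close>. By the identities
      \<open>t\<close> these are the entries of multiplication by \<open>c\<close>.\<close>
    have "c * z = S (R (S z))" for z
    proof -
      have 1: "Im (c * z) = Im (S (R (S z)))"
      proof -
        have "Im (S (R (S z))) = s * Re z + (1 + s * t) * Im z"
          by (simp add: S_def R_def algebra_simps)
        then show ?thesis by (simp only: t) (simp add: s_def)
      qed
      have "Re (S (R (S z))) = (1 + s * t) * Re z + (t + t * (1 + s * t)) * Im z"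
        by (simp add: S_def R_def algebra_simps)
      then have "Re (c * z) = Re (S (R (S z)))"
        by (simp only: t) (simp add: t)
      with 1 show ?thesis by (simp add: complex_eq_iff)
    qed
    then have "(\<integral>\<^sup>+ z. g (c * z) \<partial>lborel) = (\<integral>\<^sup>+ z. g (S (R (S z))) \<partial>lborel)"
      by simp
    also have "\<dots> = (\<integral>\<^sup>+ z. g (S (R z)) \<partial>lborel)"
      using nn_integral_complex_shear(1)[of "\<lambda>z. g (S (R z))" t] by (simp add: S_def)
    also have "\<dots> = (\<integral>\<^sup>+ z. g (S z) \<partial>lborel)"
      using nn_integral_complex_shear(2)[of "\<lambda>z. g (S z)" s] by (simp add: R_def)
    also have "\<dots> = (\<integral>\<^sup>+ z. g z \<partial>lborel)"
      using nn_integral_complex_shear(1)[of g t] by (simp add: S_def)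
    finally show ?thesis .
  qed
  show ?thesis
  proof (cases "a = -1")
    case True
    have "(\<integral>\<^sup>+ z. f (a * z) \<partial>lborel) = (\<integral>\<^sup>+ z. f (\<i> * (\<i> * z)) \<partial>lborel)"
      by (simp add: True mult.assoc[symmetric] del: mult.assoc)
    also have "\<dots> = (\<integral>\<^sup>+ z. f (\<i> * z) \<partial>lborel)"
      by (rule rot[of "\<lambda>z. f (\<i> * z)" \<i>]) (auto simp: complex_eq_iff)
    also have "\<dots> = (\<integral>\<^sup>+ z. f z \<partial>lborel)"
      by (rule rot) (auto simp: complex_eq_iff)
    finally show ?thesis .
  next
    case False
    then show ?thesis by (rule rot[OF assms])
  qed
qed

lemma nn_integral_complex_affine:
  fixes f :: "complex \<Rightarrow> ennreal"
  assumes [measurable]: "f \<in> borel_measurable borel" and a: "cmod a = 1"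
  shows "(\<integral>\<^sup>+ z. f (a * z + b) \<partial>lborel) = (\<integral>\<^sup>+ z. f z \<partial>lborel)"
  using nn_integral_complex_rotate[of "\<lambda>z. f (z + b)" a] a
  by (simp add: nn_integral_complex_translate)

section \<open>The total Gaussian mass\<close>

lemma nn_integral_complex_gaussian:
  assumes r: "r > 0"
  shows "(\<integral>\<^sup>+ z. ennreal (exp (- r * (cmod z)\<^sup>2 / 2)) \<partial>lborel) = ennreal (2 * pi / r)"
proof -
  \<comment> \<open>The variance \<open>1 / r\<close> matches the exponent
    \<open>- r * x^2 / 2\<close>, and \<open>c\<close> is the reciprocal of the normalising factor
    of that density. Each coordinate then contributes one factor \<open>c\<close>.\<close>
  define \<sigma> where "\<sigma> = 1 / sqrt r"
  define c where "c = sqrt (2 * pi / r)"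
  have c: "c > 0" "c * c = 2 * pi / r"
    using r by (simp_all add: c_def)
  have nd: "exp (- r * x\<^sup>2 / 2) = c * normal_density 0 \<sigma> x" for x
    using r by (simp add: normal_density_def \<sigma>_def c_def power_divide)
  have one: "(\<integral>\<^sup>+ x. ennreal (exp (- r * x\<^sup>2 / 2)) \<partial>lborel) = ennreal c"
  proof -
    have "(\<integral>\<^sup>+ x. ennreal (exp (- r * x\<^sup>2 / 2)) \<partial>lborel) =
        ennreal c * (\<integral>\<^sup>+ x. ennreal (normal_density 0 \<sigma> x) \<partial>lborel)"
      unfolding nd using c by (subst nn_integral_cmult[symmetric]) (auto simp: ennreal_mult)
    also have "(\<integral>\<^sup>+ x. ennreal (normal_density 0 \<sigma> x) \<partial>lborel) = 1"
      using r by (subst nn_integral_eq_integral) (auto simp: \<sigma>_def)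
    finally show ?thesis by simp
  qed
  have "(\<integral>\<^sup>+ z. ennreal (exp (- r * (cmod z)\<^sup>2 / 2)) \<partial>lborel) =
      (\<integral>\<^sup>+ y. \<integral>\<^sup>+ x. ennreal (exp (- r * x\<^sup>2 / 2)) * ennreal (exp (- r * y\<^sup>2 / 2)) \<partial>lborel \<partial>lborel)"
    by (subst nn_integral_complex(1))
      (auto simp: cmod_def ennreal_mult[symmetric] exp_add[symmetric] field_simps intro!: nn_integral_cong)
  also have "\<dots> = (\<integral>\<^sup>+ y. ennreal c * ennreal (exp (- r * y\<^sup>2 / 2)) \<partial>lborel)"
    by (intro nn_integral_cong) (subst nn_integral_multc, auto simp: one[simplified])
  also have "\<dots> = ennreal c * ennreal c"
    by (subst nn_integral_cmult) (auto simp: one[simplified])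
  also have "\<dots> = ennreal (2 * pi / r)"
    using c by (simp add: ennreal_mult[symmetric] less_imp_le)
  finally show ?thesis .
qed

section \<open>The mean value property, on circles and against radial weights\<close>

text \<open>Cauchy's formula on the unit circle for \<open>w \<mapsto> h (w * z)\<close> gives the
  mean value over the circle through \<open>z\<close>. Rescaling the variable avoids a separate
  treatment of \<open>z = 0\<close>.\<close>

lemma norm_centre_le_circle_nn_integral:
  assumes holo: "h holomorphic_on UNIV"
  shows "ennreal (cmod (h 0)) \<le>
    (\<integral>\<^sup>+ t\<in>{0..1}. ennreal (cmod (h (exp (2 * of_real pi * \<i> * of_real t) * z))) \<partial>lborel)"
proof -
  define g where "g = (\<lambda>w. h (w * z))"
  define e where "e = (\<lambda>t::real. exp (2 * of_real pi * \<i> * of_real t))"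
  have holg: "g holomorphic_on UNIV"
    unfolding g_def
    by (rule holomorphic_on_compose_gen[OF _ holo, unfolded o_def]) (auto intro!: holomorphic_intros)
  have "((\<lambda>w. g w / (w - 0)) has_contour_integral 2 * of_real pi * \<i> * g 0) (circlepath 0 1)"
    by (rule Cauchy_integral_circlepath_simple) (auto intro: holomorphic_on_subset[OF holg])
  then have "((\<lambda>t. g (circlepath 0 1 t) / circlepath 0 1 t *
      vector_derivative (circlepath 0 1) (at t within {0..1}))
      has_integral 2 * of_real pi * \<i> * g 0) {0..1}"
    by (simp add: has_contour_integral_def)
  then have "((\<lambda>t. 2 * of_real pi * \<i> * g (e t)) has_integral 2 * of_real pi * \<i> * g 0) {0..1}"
  proof (rule has_integral_eq[rotated])
    fix t :: real
    assume "t \<in> {0..1}"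
    then have "vector_derivative (circlepath 0 1) (at t within {0..1}) = 2 * of_real pi * \<i> * e t"
      by (simp add: vector_derivative_circlepath01 e_def)
    moreover have "circlepath 0 1 t = e t" "e t \<noteq> 0"
      by (simp_all add: circlepath e_def)
    ultimately show "g (circlepath 0 1 t) / circlepath 0 1 t *
        vector_derivative (circlepath 0 1) (at t within {0..1}) =
        2 * of_real pi * \<i> * g (e t)"
      by simp
  qed
  then have "((\<lambda>t. inverse (2 * of_real pi * \<i>) * (2 * of_real pi * \<i> * g (e t))) has_integral
      inverse (2 * of_real pi * \<i>) * (2 * of_real pi * \<i> * g 0)) {0..1}"
    by (rule has_integral_mult_right)
  then have hi: "((\<lambda>t. g (e t)) has_integral g 0) {0..1}"
    by (simp add: field_simps)
  have "continuous_on UNIV (\<lambda>t. g (e t))"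
    unfolding e_def
    by (rule continuous_on_compose2[OF holomorphic_on_imp_continuous_on[OF holg]]) (auto intro!: continuous_intros)
  then have "set_integrable lborel {0..1} (\<lambda>t. g (e t))"
    by (intro borel_integrable_atLeastAtMost') (auto intro: continuous_on_subset)
  then have si: "integrable lborel (\<lambda>t. indicator {0..1} t *\<^sub>R g (e t))"
    and "(LINT t:{0..1}|lborel. g (e t)) = integral {0..1} (\<lambda>t. g (e t))"
    using set_borel_integral_eq_integral(2) by (auto simp: set_integrable_def)
  then have "g 0 = (LINT t|lborel. indicator {0..1} t *\<^sub>R g (e t))"
    using integral_unique[OF hi] by (simp add: set_lebesgue_integral_def)
  then have "ennreal (cmod (g 0)) \<le> (\<integral>\<^sup>+ t. ennreal (norm (indicator {0..1} t *\<^sub>R g (e t))) \<partial>lborel)"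
    using integral_norm_bound_ennreal[OF si] by simp
  also have "\<dots> = (\<integral>\<^sup>+ t\<in>{0..1}. ennreal (cmod (g (e t))) \<partial>lborel)"
    by (intro nn_integral_cong) (auto simp: indicator_def)
  finally show ?thesis
    by (simp add: g_def e_def)
qed

text \<open>Integrate the circle inequality over all \<open>z\<close> against the weight and
  exchange the integrals. As the weight is radial and area is rotation invariant, the integral over
  \<open>z\<close> does not depend on the angle \<open>t\<close>, which ranges over an interval of
  length 1.\<close>

lemma norm_centre_mult_radial_nn_integral_le:
  fixes \<phi> :: "real \<Rightarrow> ennreal"
  assumes holo: "h holomorphic_on UNIV" and [measurable]: "\<phi> \<in> borel_measurable borel"
  shows "ennreal (cmod (h 0)) * (\<integral>\<^sup>+ z. \<phi> (cmod z) \<partial>lborel) \<le>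
    (\<integral>\<^sup>+ z. ennreal (cmod (h z)) * \<phi> (cmod z) \<partial>lborel)"
proof -
  define e where "e = (\<lambda>t::real. exp (2 * of_real pi * \<i> * of_real t))"
  have ne: "cmod (e t) = 1" for t
    by (simp add: e_def)
  have [measurable]: "e \<in> borel_measurable borel"
    unfolding e_def by (intro borel_measurable_continuous_onI continuous_intros)
  have [measurable]: "h \<in> borel_measurable borel"
    using holo by (intro borel_measurable_continuous_onI holomorphic_on_imp_continuous_on)
  define F where "F = (\<lambda>z. ennreal (cmod (h z)) * \<phi> (cmod z))"
  have [measurable]: "F \<in> borel_measurable borel"
    unfolding F_def by measurable
  have "ennreal (cmod (h 0)) * (\<integral>\<^sup>+ z. \<phi> (cmod z) \<partial>lborel) = (\<integral>\<^sup>+ z. ennreal (cmod (h 0)) * \<phi> (cmod z) \<partial>lborel)"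
    by (subst nn_integral_cmult) auto
  also have "\<dots> \<le> (\<integral>\<^sup>+ z. (\<integral>\<^sup>+ t\<in>{0..1}. ennreal (cmod (h (e t * z))) \<partial>lborel) * \<phi> (cmod z) \<partial>lborel)"
    unfolding e_def
    by (intro nn_integral_mono mult_right_mono norm_centre_le_circle_nn_integral[OF holo]) auto
  also have "\<dots> = (\<integral>\<^sup>+ z. \<integral>\<^sup>+ t. F (e t * z) * indicator {0..1} t \<partial>lborel \<partial>lborel)"
    by (intro nn_integral_cong, subst nn_integral_multc[symmetric])
      (auto simp: F_def norm_mult ne mult_ac)
  also have "\<dots> = (\<integral>\<^sup>+ t. \<integral>\<^sup>+ z. F (e t * z) * indicator {0..1} t \<partial>lborel \<partial>lborel)"
    by (rule lborel_pair.Fubini') measurable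
  also have "\<dots> = (\<integral>\<^sup>+ t\<in>{0..1::real}. (\<integral>\<^sup>+ z. F z \<partial>lborel) \<partial>lborel)"
  proof (rule nn_integral_cong)
    fix t
    have "(\<integral>\<^sup>+ z. F (e t * z) * indicator {0..1} t \<partial>lborel) =
        (\<integral>\<^sup>+ z. F (e t * z) \<partial>lborel) * indicator {0..1} t"
      by (rule nn_integral_multc) measurable
    then show "(\<integral>\<^sup>+ z. F (e t * z) * indicator {0..1} t \<partial>lborel) = (\<integral>\<^sup>+ z. F z \<partial>lborel) * indicator {0..1} t"
      by (simp add: nn_integral_complex_rotate ne)
  qed
  also have "\<dots> = (\<integral>\<^sup>+ z. F z \<partial>lborel)"
    by (subst nn_integral_cmult) auto
  finally show ?thesis
    by (simp add: F_def)
qed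

section \<open>The Fock norm under scaling and affine isometries\<close>

text \<open>The Gaussian of \<open>fock_integral r\<close> is the \<open>r\<close>-th power of the
  one here, so a single weighted modulus serves all exponents, including
  \<open>p = \<infinity>\<close>.\<close>

definition fock_mod :: "(complex \<Rightarrow> complex) \<Rightarrow> complex \<Rightarrow> real" where
  "fock_mod f z = cmod (f z) * exp (- (cmod z)\<^sup>2 / 2)"

lemma fock_mod_nonneg [simp]: "0 \<le> fock_mod f z"
  by (simp add: fock_mod_def)

lemma fock_mod_measurable:
  assumes "f holomorphic_on UNIV"
  shows "fock_mod f \<in> borel_measurable borel"
  unfolding fock_mod_def
  by (intro borel_measurable_continuous_onI continuous_intros holomorphic_on_imp_continuous_on assms) auto

lemma fock_integral_eq: "fock_integral r f = (\<integral>\<^sup>+ z. ennreal (fock_mod f z powr r) \<partial>lborel)"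
  unfolding fock_integral_def fock_mod_def
  by (intro nn_integral_cong) (simp add: powr_mult exp_powr_real mult_ac)

lemma fock_norm_top_eq: "fock_norm top f = (SUP z. ennreal (fock_mod f z))"
  by (simp add: fock_norm_def fock_mod_def)

lemma fock_norm_finite_eq:
  assumes "p \<noteq> \<infinity>" "fock_integral (enn2real p) f \<noteq> \<infinity>"
  shows "fock_norm p f =
    ennreal ((enn2real p / (2 * pi) * enn2real (fock_integral (enn2real p) f)) powr (1 / enn2real p))"
  using assms by (simp add: fock_norm_def Let_def)

lemma fock_spaceD:
  assumes "f \<in> fock_space p"
  shows "f holomorphic_on UNIV" "fock_norm p f < \<infinity>" "p \<noteq> \<infinity> \<Longrightarrow> fock_integral (enn2real p) f \<noteq> \<infinity>"
  using assms by (auto simp: fock_space_def fock_norm_def Let_def split: if_splits)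

lemma enn2real_ge_1:
  assumes "1 \<le> p" "p \<noteq> \<infinity>"
  shows "1 \<le> enn2real p"
  using assms enn2real_mono[of 1 p] by (simp add: top.not_eq_extremum)

text \<open>The affine map is absorbed by surjectivity in the supremum and by invariance of area in
  the integral; the constant leaves the integral as \<open>c powr r\<close> and the root as
  \<open>c\<close>. Kernels, translates and the operator itself are all measured this way.\<close>

lemma fock_norm_scaled_affine:
  assumes p: "1 \<le> p" and f: "f \<in> fock_space p" and a: "cmod a = 1" and c: "0 \<le> c"
    and h: "\<And>z. fock_mod h z = c * fock_mod f (a * z + b)"
  shows "fock_norm p h = ennreal c * fock_norm p f"
proof (cases "p = \<infinity>")
  case True
  have "surj (\<lambda>z. a * z + b)"
  proof (rule surjI)
    show "a * ((w - b) / a) + b = w" for w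
      using a by auto
  qed
  then have "(SUP z. ennreal (fock_mod f (a * z + b))) = (SUP z. ennreal (fock_mod f z))"
    by (metis (no_types) image_image)
  then show ?thesis
    using c by (simp add: True fock_norm_top_eq h ennreal_mult SUP_mult_left_ennreal[symmetric])
next
  case False
  define r where "r = enn2real p"
  have r: "1 \<le> r"
    using enn2real_ge_1[OF p False] by (simp add: r_def)
  have [measurable]: "fock_mod f \<in> borel_measurable borel"
    using fock_spaceD[OF f] by (intro fock_mod_measurable)
  have "fock_integral r h = (\<integral>\<^sup>+ z. ennreal (c powr r) * ennreal (fock_mod f (a * z + b) powr r) \<partial>lborel)"
    using c by (simp add: fock_integral_eq h powr_mult ennreal_mult)
  also have "\<dots> = ennreal (c powr r) * (\<integral>\<^sup>+ z. ennreal (fock_mod f (a * z + b) powr r) \<partial>lborel)"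
    by (rule nn_integral_cmult) measurable
  also have "\<dots> = ennreal (c powr r) * fock_integral r f"
    using nn_integral_complex_affine[of "\<lambda>z. ennreal (fock_mod f z powr r)" a b] a
    by (simp add: fock_integral_eq)
  finally have I: "fock_integral r h = ennreal (c powr r) * fock_integral r f" .
  \<comment> \<open>Finiteness passes from \<open>f\<close> to \<open>h\<close>, so both norms are
    given by the root branch of the definition.\<close>
  have fin: "fock_integral r f \<noteq> \<infinity>"
    using fock_spaceD(3)[OF f False] by (simp add: r_def)
  with I have "fock_integral r h \<noteq> \<infinity>"
    by (simp add: ennreal_mult_eq_top_iff)
  then have "fock_norm p h = ennreal ((r / (2 * pi) * (c powr r * enn2real (fock_integral r f))) powr (1 / r))"
    using fock_norm_finite_eq[OF False, of h] I by (simp add: r_def enn2real_mult)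
  also have "(r / (2 * pi) * (c powr r * enn2real (fock_integral r f))) powr (1 / r) =
      (c powr r * (r / (2 * pi) * enn2real (fock_integral r f))) powr (1 / r)"
    by (simp add: mult_ac)
  also have "\<dots> = c * (r / (2 * pi) * enn2real (fock_integral r f)) powr (1 / r)"
    using r c by (subst powr_mult) (auto simp: powr_powr)
  finally show ?thesis
    using fock_norm_finite_eq[OF False, of f] fin c by (simp add: r_def ennreal_mult)
qed

section \<open>The constant function 1 and the kernels as unit vectors\<close>

lemma fock_norm_one:
  assumes p: "1 \<le> p"
  shows "fock_norm p (\<lambda>_. 1) = 1"
proof (cases "p = \<infinity>")
  case True
  have "(SUP z. ennreal (fock_mod (\<lambda>_. 1) z)) = 1"
  proof (rule antisym)
    show "(SUP z. ennreal (fock_mod (\<lambda>_. 1) z)) \<le> 1"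
      by (intro SUP_least) (simp add: fock_mod_def)
    show "1 \<le> (SUP z. ennreal (fock_mod (\<lambda>_. 1) z))"
      by (rule SUP_upper2[of 0]) (auto simp: fock_mod_def)
  qed
  then show ?thesis
    by (simp add: True fock_norm_top_eq)
next
  case False
  have r: "enn2real p \<ge> 1"
    by (rule enn2real_ge_1[OF p False])
  then have I: "fock_integral (enn2real p) (\<lambda>_. 1) = ennreal (2 * pi / enn2real p)"
    using nn_integral_complex_gaussian[of "enn2real p"] by (simp add: fock_integral_def)
  show ?thesis
    using r by (subst fock_norm_finite_eq[OF False]) (auto simp: I)
qed

lemma one_in_fock_space:
  assumes "1 \<le> p"
  shows "(\<lambda>_. 1) \<in> fock_space p"
  using fock_norm_one[OF assms] by (simp add: fock_space_def)

text \<open>The reproducing kernel at \<open>w\<close> of the Fock space with \<open>p = 2\<close>,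
  divided by its norm there.\<close>

definition fock_kernel :: "complex \<Rightarrow> complex \<Rightarrow> complex" where
  "fock_kernel w z = exp (cnj w * z - of_real ((cmod w)\<^sup>2 / 2))"

text \<open>Completing the square in the exponent produces a Gaussian centred at
  \<open>w\<close>.\<close>

lemma fock_mod_kernel: "fock_mod (fock_kernel w) z = fock_mod (\<lambda>_. 1) (z - w)"
proof -
  have "Re (cnj w * z) - (cmod w)\<^sup>2 / 2 - (cmod z)\<^sup>2 / 2 = - (cmod (z - w))\<^sup>2 / 2"
    by (simp only: cmod_power2) (simp add: power2_eq_square field_simps)
  then show ?thesis
    by (simp add: fock_mod_def fock_kernel_def exp_add[symmetric] del: complex_cnj_mult mult.commute)
qed

lemma fock_norm_kernel:
  assumes "1 \<le> p"
  shows "fock_norm p (fock_kernel w) = 1"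
  using fock_norm_scaled_affine[OF assms one_in_fock_space[OF assms], of 1 1 "fock_kernel w" "- w"]
  by (simp add: fock_mod_kernel fock_norm_one[OF assms])

lemma fock_kernel_in_fock_space:
  assumes "1 \<le> p"
  shows "fock_kernel w \<in> fock_space p"
proof -
  have "fock_kernel w holomorphic_on UNIV"
    unfolding fock_kernel_def by (intro holomorphic_intros)
  then show ?thesis
    using fock_norm_kernel[OF assms] by (simp add: fock_space_def)
qed

section \<open>Uniform bounds for point evaluations\<close>

text \<open>The Gaussian mean of \<open>cmod (g z)\<close> dominates \<open>cmod (g 0)\<close>.
  Bounding the integrand by \<open>x \<le> 1 + x powr r\<close> leaves the Gaussian mass
  \<open>2 * pi / r\<close> plus \<open>fock_integral r g\<close>; division by that mass yields the
  claim.\<close>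

lemma fock_mod_centre_le:
  assumes p: "1 \<le> p" "p \<noteq> \<infinity>" and g: "g \<in> fock_space p" and B: "0 \<le> B" "fock_norm p g \<le> ennreal B"
  shows "fock_mod g 0 \<le> 1 + B powr enn2real p"
proof -
  define r where "r = enn2real p"
  have r: "1 \<le> r"
    using enn2real_ge_1[OF p] by (simp add: r_def)
  define I where "I = enn2real (fock_integral r g)"
  have I: "fock_integral r g = ennreal I" "0 \<le> I"
    using fock_spaceD(3)[OF g p(2)] by (auto simp: I_def r_def top.not_eq_extremum)
  have "(r / (2 * pi) * I) powr (1 / r) \<le> B"
    using B fock_norm_finite_eq[OF p(2), of g] I by (simp add: r_def)
  then have "((r / (2 * pi) * I) powr (1 / r)) powr r \<le> B powr r"
    using r by (intro powr_mono2) auto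
  then have IB: "r / (2 * pi) * I \<le> B powr r"
    using r I(2) by (simp add: powr_powr)
  have holo: "g holomorphic_on UNIV"
    by (rule fock_spaceD(1)[OF g])
  have [measurable]: "g \<in> borel_measurable borel"
    using holo by (intro borel_measurable_continuous_onI holomorphic_on_imp_continuous_on)
  \<comment> \<open>This crude bound replaces Jensen's inequality: only boundedness of point evaluation
    matters, not its norm.\<close>
  have le: "x \<le> 1 + x powr r" if "x \<ge> 0" for x :: real
  proof (cases "x \<le> 1")
    case False
    then have "x powr 1 \<le> x powr r" using r by (intro powr_mono) auto
    with False show ?thesis by simp
  qed (use that in \<open>auto intro: add_increasing2\<close>)
  have "ennreal (cmod (g 0) * (2 * pi / r)) =
      ennreal (cmod (g 0)) * (\<integral>\<^sup>+ z. ennreal (exp (- r * (cmod z)\<^sup>2 / 2)) \<partial>lborel)"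
    using r by (subst nn_integral_complex_gaussian) (auto simp: ennreal_mult[symmetric])
  also have "\<dots> \<le> (\<integral>\<^sup>+ z. ennreal (cmod (g z)) * ennreal (exp (- r * (cmod z)\<^sup>2 / 2)) \<partial>lborel)"
    by (rule norm_centre_mult_radial_nn_integral_le[OF holo, of "\<lambda>x. ennreal (exp (- r * x\<^sup>2 / 2))"]) measurable
  also have "\<dots> \<le> (\<integral>\<^sup>+ z. ennreal (exp (- r * (cmod z)\<^sup>2 / 2)) +
      ennreal (cmod (g z) powr r * exp (- r * (cmod z)\<^sup>2 / 2)) \<partial>lborel)"
  proof (intro nn_integral_mono)
    fix z
    have "cmod (g z) * exp (- r * (cmod z)\<^sup>2 / 2) \<le> (1 + cmod (g z) powr r) * exp (- r * (cmod z)\<^sup>2 / 2)"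
      by (intro mult_right_mono le) auto
    then show "ennreal (cmod (g z)) * ennreal (exp (- r * (cmod z)\<^sup>2 / 2)) \<le> ennreal (exp (- r * (cmod z)\<^sup>2 / 2)) +
      ennreal (cmod (g z) powr r * exp (- r * (cmod z)\<^sup>2 / 2))"
      by (simp add: ennreal_mult[symmetric] ennreal_plus[symmetric] distrib_right del: ennreal_plus)
  qed
  also have "\<dots> = ennreal (2 * pi / r) + fock_integral r g"
    unfolding fock_integral_def
    using r nn_integral_complex_gaussian[of r] by (subst nn_integral_add) auto
  also have "\<dots> = ennreal (2 * pi / r + I)"
    using r I by simp
  finally have "cmod (g 0) * (2 * pi / r) \<le> 2 * pi / r + I"
    using r I(2) by (simp del: ennreal_plus)
  then have "cmod (g 0) \<le> 1 + r / (2 * pi) * I"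
    using r by (simp add: field_simps)
  with IB show ?thesis
    by (simp add: fock_mod_def r_def)
qed

text \<open>The point is that \<open>C\<close> does not depend on \<open>z\<close>: a
  norm-preserving translation moves \<open>z\<close> to the origin.\<close>

lemma fock_point_evaluation_bounded:
  assumes p: "1 \<le> p" and B: "0 \<le> B"
  obtains C where "\<And>g z. g \<in> fock_space p \<Longrightarrow> fock_norm p g \<le> ennreal B \<Longrightarrow> fock_mod g z \<le> C"
proof (cases "p = \<infinity>")
  case True
  show ?thesis
  proof (rule that)
    fix g z
    assume "fock_norm p g \<le> ennreal B"
    moreover have "ennreal (fock_mod g z) \<le> (SUP z. ennreal (fock_mod g z))"
      by (rule SUP_upper) simp
    ultimately have "ennreal (fock_mod g z) \<le> ennreal B"
      by (simp add: True fock_norm_top_eq)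
    then show "fock_mod g z \<le> B"
      using B by simp
  qed
next
  case False
  show ?thesis
  proof (rule that)
    fix g z
    assume g: "g \<in> fock_space p" and gB: "fock_norm p g \<le> ennreal B"
    \<comment> \<open>The kernel factor corrects the Gaussian weight, so that \<open>G\<close> is
      entire and its weighted modulus is exactly that of \<open>g\<close> shifted by
      \<open>z\<close>.\<close>
    define G where "G = (\<lambda>\<zeta>. fock_kernel (- z) \<zeta> * g (\<zeta> + z))"
    have "g holomorphic_on UNIV"
      by (rule fock_spaceD(1)[OF g])
    then have "(\<lambda>\<zeta>. g (\<zeta> + z)) holomorphic_on UNIV"
      by (rule holomorphic_on_compose_gen[unfolded o_def, rotated]) (auto intro!: holomorphic_intros)
    then have hG: "G holomorphic_on UNIV"
      unfolding G_def fock_kernel_def by (intro holomorphic_intros)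
    have GM: "fock_mod G \<zeta> = fock_mod g (\<zeta> + z)" for \<zeta>
    proof -
      have "fock_mod G \<zeta> = fock_mod (fock_kernel (- z)) \<zeta> * cmod (g (\<zeta> + z))"
        by (simp add: fock_mod_def G_def norm_mult)
      then show ?thesis
        by (simp add: fock_mod_kernel) (simp add: fock_mod_def)
    qed
    have nG: "fock_norm p G = fock_norm p g"
      using fock_norm_scaled_affine[OF p g, of 1 1 G z] by (simp add: GM)
    then have "G \<in> fock_space p"
      using hG fock_spaceD(2)[OF g] by (simp add: fock_space_def)
    from fock_mod_centre_le[OF p False this B] gB nG
    show "fock_mod g z \<le> 1 + B powr enn2real p"
      by (simp add: GM)
  qed
qed

section \<open>Boundedness determines the weight up to a constant\<close>

lemma fock_bounded_weight_eq:
  assumes p: "1 \<le> p" and u: "u holomorphic_on UNIV" and bd: "fock_bounded p (weighted_comp u \<psi>)"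
    and \<psi>: "\<And>z. \<psi> z = a * z + b" and a: "cmod a = 1"
  shows "u z = u 0 * exp (- (a * cnj b * z))"
proof -
  let ?W = "weighted_comp u \<psi>"
  obtain B where B: "fock_opnorm p ?W = ennreal B" "0 \<le> B"
    using bd by (cases "fock_opnorm p ?W") (auto simp: fock_bounded_def)
  obtain C where C: "\<And>g z. g \<in> fock_space p \<Longrightarrow> fock_norm p g \<le> ennreal B \<Longrightarrow> fock_mod g z \<le> C"
    using fock_point_evaluation_bounded[OF p B(2)] by blast
  \<comment> \<open>The exponential is the entire function whose modulus carries the cross term
    \<open>Re (a * cnj b * z)\<close> of \<open>(cmod (\<psi> z))^2 / 2\<close>.\<close>
  define v where "v = (\<lambda>z. u z * exp (a * cnj b * z))"
  have "cmod (v z) \<le> C" for z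
  proof -
    \<comment> \<open>The weighted modulus of the kernel at \<open>w\<close> peaks at
      \<open>w\<close>, so this choice gives the strongest bound on \<open>u z\<close>: the kernel
      takes the value \<open>exp ((cmod w)^2 / 2)\<close> at \<open>\<psi> z\<close>.\<close>
    define w where "w = \<psi> z"
    have k: "fock_kernel w \<in> fock_space p" "fock_norm p (fock_kernel w) \<le> 1"
      using fock_kernel_in_fock_space[OF p] fock_norm_kernel[OF p] by auto
    have "?W (fock_kernel w) \<in> fock_space p"
      using bd k by (auto simp: fock_bounded_def)
    moreover have "fock_norm p (?W (fock_kernel w)) \<le> fock_opnorm p ?W"
      unfolding fock_opnorm_def using k by (intro SUP_upper) auto
    ultimately have "fock_mod (?W (fock_kernel w)) z \<le> C"
      using C B by simp
    have "Re (cnj w * w - of_real ((cmod w)\<^sup>2 / 2)) + (- (cmod z)\<^sup>2 / 2) =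
        Re (a * cnj b * z) + (cmod b)\<^sup>2 / 2"
    proof -
      have "(cmod w)\<^sup>2 = (cmod (a * z))\<^sup>2 + (cmod b)\<^sup>2 + 2 * Re (a * cnj b * z)"
        unfolding w_def \<psi> by (simp only: cmod_power2) (simp add: power2_eq_square algebra_simps)
      moreover have "Re (cnj w * w) = (cmod w)\<^sup>2"
        by (simp only: cmod_power2) (simp add: power2_eq_square)
      ultimately show ?thesis
        using a by (simp add: norm_mult field_simps)
    qed
    then have "fock_mod (?W (fock_kernel w)) z = cmod (v z) * exp ((cmod b)\<^sup>2 / 2)"
      by (simp add: fock_mod_def weighted_comp_def fock_kernel_def v_def w_def[symmetric] norm_mult
          mult.assoc exp_add[symmetric])
    moreover have "cmod (v z) * 1 \<le> cmod (v z) * exp ((cmod b)\<^sup>2 / 2)"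
      by (intro mult_left_mono) auto
    ultimately show ?thesis
      using \<open>fock_mod (?W (fock_kernel w)) z \<le> C\<close> by simp
  qed
  then have "bounded (range v)"
    by (auto simp: bounded_iff)
  moreover have "v holomorphic_on UNIV"
    unfolding v_def by (intro holomorphic_intros u)
  ultimately have "v constant_on UNIV"
    by (intro Liouville_theorem)
  then have "v z = v 0"
    by (auto simp: constant_on_def)
  then show ?thesis
    by (simp add: v_def exp_minus field_simps)
qed

section \<open>Powers of the operator\<close>

text \<open>Taking \<open>f\<close> constantly 1 makes the weight products the orbit of 1 under the
  operator.\<close>

lemma weighted_comp_funpow:
  "(weighted_comp u \<psi> ^^ n) f = (\<lambda>z. weight_prod u \<psi> n z * f ((\<psi> ^^ n) z))"
proof (induction n)
  case (Suc n)
  have "(weighted_comp u \<psi> ^^ Suc n) f =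
      weighted_comp u \<psi> (\<lambda>z. weight_prod u \<psi> n z * f ((\<psi> ^^ n) z))"
    by (simp only: funpow.simps o_apply Suc.IH)
  \<comment> \<open>The outermost application supplies the factor for \<open>j = 0\<close> and
    shifts the remaining indices by one.\<close>
  also have "\<dots> = (\<lambda>z. weight_prod u \<psi> (Suc n) z * f ((\<psi> ^^ Suc n) z))"
    by (simp add: weighted_comp_def weight_prod_def prod.lessThan_Suc_shift funpow_swap1
        mult.assoc del: prod.lessThan_Suc)
  finally show ?case .
qed (simp add: weight_prod_def)

text \<open>Each application multiplies the norm by the same constant. Membership in the space is
  carried through the induction because the next application needs it.\<close>

lemma fock_norm_weighted_comp_funpow:
  assumes p: "1 \<le> p" and u: "u holomorphic_on UNIV" and bd: "fock_bounded p (weighted_comp u \<psi>)"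
    and \<psi>: "\<And>z. \<psi> z = a * z + b" and a: "cmod a = 1" and f: "f \<in> fock_space p"
  shows "(weighted_comp u \<psi> ^^ n) f \<in> fock_space p \<and>
    fock_norm p ((weighted_comp u \<psi> ^^ n) f) =
      ennreal ((cmod (u 0) * exp ((cmod b)\<^sup>2 / 2)) ^ n) * fock_norm p f"
proof (induction n)
  case (Suc n)
  define c where "c = cmod (u 0) * exp ((cmod b)\<^sup>2 / 2)"
  let ?W = "weighted_comp u \<psi>"
  have step: "fock_norm p (?W g) = ennreal c * fock_norm p g" if g: "g \<in> fock_space p" for g
  proof (rule fock_norm_scaled_affine[OF p g a])
    fix z
    have "(cmod (a * z + b))\<^sup>2 = (cmod (a * z))\<^sup>2 + (cmod b)\<^sup>2 + 2 * Re (a * cnj b * z)"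
      by (simp only: cmod_power2) (simp add: power2_eq_square algebra_simps)
    then have "- Re (a * cnj b * z) + (- (cmod z)\<^sup>2 / 2) = (cmod b)\<^sup>2 / 2 + (- (cmod (a * z + b))\<^sup>2 / 2)"
      using a by (simp add: norm_mult field_simps)
    \<comment> \<open>The decay or growth of \<open>u\<close> in \<open>z\<close> exactly offsets
      the cross term of \<open>(cmod (a * z + b))^2\<close>; only a constant factor
      survives.\<close>
    then have e: "exp (- Re (a * cnj b * z)) * exp (- (cmod z)\<^sup>2 / 2) =
        exp ((cmod b)\<^sup>2 / 2) * exp (- (cmod (a * z + b))\<^sup>2 / 2)"
      by (simp only: exp_add[symmetric])
    have "cmod (u z) = cmod (u 0) * exp (- Re (a * cnj b * z))"
      by (subst fock_bounded_weight_eq[OF p u bd \<psi> a]) (simp add: norm_mult)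
    then have "fock_mod (?W g) z =
        cmod (u 0) * cmod (g (a * z + b)) *
          (exp (- Re (a * cnj b * z)) * exp (- (cmod z)\<^sup>2 / 2))"
      unfolding fock_mod_def weighted_comp_def \<psi> norm_mult by (simp only: mult_ac)
    then show "fock_mod (?W g) z = c * fock_mod g (a * z + b)"
      unfolding e by (simp add: fock_mod_def c_def mult_ac)
  qed (simp add: c_def)
  have "?W ((?W ^^ n) f) \<in> fock_space p"
    using bd Suc.IH by (auto simp: fock_bounded_def)
  with step[of "(?W ^^ n) f"] Suc.IH show ?case
    by (simp add: c_def ennreal_mult mult_ac)
qed (use f in auto)

section \<open>Reduction of all three conditions to boundedness of a geometric sequence\<close>

theorem theorem2p1:
  fixes p :: ennreal and u \<psi> :: "complex \<Rightarrow> complex" and a b :: complex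
  assumes "1 \<le> p"
    and "u holomorphic_on UNIV"
    and "\<psi> holomorphic_on UNIV"
    and "fock_bounded p (weighted_comp u \<psi>)"
    and "\<And>z. \<psi> z = a * z + b"
    and "cmod a = 1"
  shows "(fock_power_bounded p (weighted_comp u \<psi>) \<longleftrightarrow>
            (\<exists>C::real. \<forall>n. fock_norm p (weight_prod u \<psi> n) \<le> ennreal C))
       \<and> ((\<exists>C::real. \<forall>n. fock_norm p (weight_prod u \<psi> n) \<le> ennreal C) \<longleftrightarrow>
            cmod (u 0) \<le> exp (- (cmod b)\<^sup>2 / 2))
       \<and> (\<forall>n. fock_opnorm p (weighted_comp u \<psi> ^^ n) =
              ennreal ((cmod (u 0) * exp ((cmod b)\<^sup>2 / 2)) ^ n))"
proof -
  let ?W = "weighted_comp u \<psi>"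
  define c where "c = cmod (u 0) * exp ((cmod b)\<^sup>2 / 2)"
  have c0: "0 \<le> c"
    by (simp add: c_def)
  have W: "fock_norm p ((?W ^^ n) f) = ennreal (c ^ n) * fock_norm p f" if "f \<in> fock_space p" for f n
    using fock_norm_weighted_comp_funpow[OF assms(1,2,4-6) that] by (simp add: c_def)
  note one = one_in_fock_space[OF assms(1)] fock_norm_one[OF assms(1)]
  have op: "fock_opnorm p (?W ^^ n) = ennreal (c ^ n)" for n
    unfolding fock_opnorm_def
  proof (rule antisym)
    show "(SUP f\<in>{f \<in> fock_space p. fock_norm p f \<le> 1}. fock_norm p ((?W ^^ n) f)) \<le> ennreal (c ^ n)"
      by (rule SUP_least) (use mult_left_mono[of _ 1 "ennreal (c ^ n)"] in \<open>auto simp: W\<close>)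
    \<comment> \<open>The constant function 1 is a unit vector and attains the supremum.\<close>
    show "ennreal (c ^ n) \<le> (SUP f\<in>{f \<in> fock_space p. fock_norm p f \<le> 1}. fock_norm p ((?W ^^ n) f))"
      by (rule SUP_upper2[of "\<lambda>_. 1"]) (use one W[of "\<lambda>_. 1" n] in auto)
  qed
  have wp: "fock_norm p (weight_prod u \<psi> n) = ennreal (c ^ n)" for n
    using W[of "\<lambda>_. 1" n] one by (simp add: weighted_comp_funpow)
  have bd_iff: "(\<exists>C::real. \<forall>n. ennreal (c ^ n) \<le> ennreal C) \<longleftrightarrow> c \<le> 1"
  proof
    assume "\<exists>C::real. \<forall>n. ennreal (c ^ n) \<le> ennreal C"
    then obtain C :: real where C: "\<And>n. ennreal (c ^ n) \<le> ennreal C"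
      by blast
    show "c \<le> 1"
    proof (rule ccontr)
      assume "\<not> c \<le> 1"
      \<comment> \<open>The maximum with 0 covers a negative \<open>C\<close>, which
        \<open>ennreal\<close> truncates to 0.\<close>
      then obtain n where n: "max C 0 < c ^ n"
        using real_arch_pow[of c "max C 0"] by auto
      with C[of n] show False
        by (simp add: ennreal_le_iff2)
    qed
  next
    assume "c \<le> 1"
    then have "\<forall>n. ennreal (c ^ n) \<le> ennreal 1"
      using c0 by (auto intro: power_le_one)
    then show "\<exists>C::real. \<forall>n. ennreal (c ^ n) \<le> ennreal C"
      by blast
  qed
  have pb_iff: "fock_power_bounded p ?W \<longleftrightarrow> (\<exists>C::real. \<forall>n. ennreal (c ^ n) \<le> ennreal C)"
  proof -
    \<comment> \<open>A finite supremum is itself a real number and serves as the bound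
      \<open>C\<close>.\<close>
    have "(SUP n. ennreal (c ^ n)) < \<infinity> \<longleftrightarrow> (\<exists>C::real. (SUP n. ennreal (c ^ n)) \<le> ennreal C)"
      by (metis ennreal_cases ennreal_less_top infinity_ennreal_def order.strict_iff_not order_le_less_trans order_refl top.not_eq_extremum)
    then show ?thesis
      using assms(4) by (simp add: fock_power_bounded_def op SUP_le_iff)
  qed
  have "c \<le> 1 \<longleftrightarrow> cmod (u 0) \<le> exp (- (cmod b)\<^sup>2 / 2)"
    by (simp add: c_def exp_minus field_simps)
  then show ?thesis
    using op pb_iff bd_iff by (simp add: wp c_def)
qed

end
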